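(* Let $\mathcal{A}$ be a torsion free Abelian group, let $a_1,\dots,a_n\in\mathcal{A}$, and let $f:\mathcal{A}\to\mathbb{Z}$ be an integer valued function. If $f=f_1+f_2+\cdots+f_n$ for some functions $f_j:\mathcal{A}\to\mathbb{R}$ with $f_j$ being $a_j$-periodic ($j=1,\dots,n$), then also $f=g_1+g_2+\cdots+g_n$ for some functions $g_j:\mathcal{A}\to\mathbb{Z}$ with $g_j$ being $a_j$-periodic ($j=1,\dots,n$).
   Context: The group $\mathcal{A}$ is written additively. A function $h$ on $\mathcal{A}$ is $a$-periodic (for $a\in\mathcal{A}$) if $h(x+a)=h(x)$ for all $x\in\mathcal{A}$. *)

theory Defs
  imports Complex_Main
begin

(* For the class ab_group_add there is no natural-number scalar multiple in the library;
   the multiple n x is the iterated sum x + ... + x with n summands. *)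
definition torsion_free :: "'a::ab_group_add itself \<Rightarrow> bool"
  where "torsion_free _ \<longleftrightarrow> (\<forall>(x::'a) (n::nat). n > 0 \<longrightarrow> (\<Sum>i<n. x) = 0 \<longrightarrow> x = 0)"

(* The library locale periodic_fun_simple requires the domain to be a ring. *)
definition periodic :: "'a::ab_group_add \<Rightarrow> ('a \<Rightarrow> 'b) \<Rightarrow> bool"
  where "periodic a h \<longleftrightarrow> (\<forall>x. h (x + a) = h x)"

end

(* Induction on the number of periods. Nonzero periods that are commensurable with a fixed one are
   multiples k_i e of one element e; let T be the translation by e. The lcm L of the polynomials
   x^(k_i) - 1 satisfies 1 = sum S_i L / (x^(k_i) - 1) with integer polynomials S_i, so an
   integer valued function u with L(T) u = 0 is the sum of the (k_i e)-periodic integer valued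
   functions S_i(T) (L / (x^(k_i) - 1))(T) u.
   The operator L(T) removes the commensurable periods from f, so by induction L(T) f is a sum of
   integer valued a_j-periodic functions h_j over the other j. For those j, the equation
   L(T) g_j = h_j has an integer valued a_j-periodic solution, because L divides the product
   of the x^(k_i) - 1 and a first-order difference equation along a direction independent of a_j
   is solved coset by coset. Then u = f - sum g_j satisfies L(T) u = 0. *)

theory Submission
  imports Defs "HOL-Computational_Algebra.Polynomial"
begin

section \<open>Integer multiples in an Abelian group\<close>

text \<open>Built from the same iterated sums as \<open>torsion_free\<close>, so that this
  hypothesis applies directly in \<open>zmul_eq_0D\<close>.\<close>

definition zmul :: "int \<Rightarrow> 'a::ab_group_add \<Rightarrow> 'a"
  where "zmul k x = (if 0 \<le> k then (\<Sum>i<nat k. x) else - (\<Sum>i<nat (- k). x))"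

lemma zmul_0 [simp]: "zmul 0 x = 0"
  by (simp add: zmul_def)

lemma zmul_add_1: "zmul (k + 1) x = zmul k x + x"
proof (cases "0 \<le> k")
  case True
  then have "nat (k + 1) = Suc (nat k)" by simp
  with True show ?thesis by (simp add: zmul_def add.commute)
next
  case False
  then have "nat (- k) = Suc (nat (- (k + 1)))" by simp
  with False show ?thesis by (auto simp: zmul_def)
qed

lemma zmul_diff_1: "zmul (k - 1) x = zmul k x - x"
  using zmul_add_1[of "k - 1" x] by (simp add: algebra_simps)

lemma zmul_1 [simp]: "zmul 1 x = x"
  using zmul_add_1[of 0 x] by simp

lemma zmul_add: "zmul (k + l) x = zmul k x + zmul l x"
proof (induction l rule: int_induct[where k = 0])
  case (step1 i)
  then show ?case using zmul_add_1[of "k + i" x] zmul_add_1[of i x] by (simp add: algebra_simps)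
next
  case (step2 i)
  have "k + (i - 1) = k + i - 1" by simp
  then show ?case unfolding zmul_diff_1 using step2 zmul_diff_1[of "k + i" x]
    by (simp only: add_diff_eq)
qed simp

lemma zmul_add_right: "zmul k (x + y) = zmul k x + zmul k y"
  by (induction k rule: int_induct[where k = 0]) (simp_all add: zmul_add_1 zmul_diff_1)

lemma zmul_zmul: "zmul k (zmul l x) = zmul (k * l) x"
proof (induction k rule: int_induct[where k = 0])
  case (step1 i)
  then show ?case by (simp add: zmul_add_1 zmul_add distrib_right)
next
  case (step2 i)
  then show ?case
    using zmul_add[of "(i - 1) * l" l x] by (simp add: zmul_diff_1 algebra_simps)
qed simp

interpretation zmul: module zmul
  by unfold_locales (simp_all add: zmul_add zmul_add_right zmul_zmul)

lemma zmul_eq_0D: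
  fixes x :: "'a::ab_group_add"
  assumes "torsion_free TYPE('a)" "zmul k x = 0" "k \<noteq> 0"
  shows "x = 0"
proof -
  have "(\<Sum>i<nat \<bar>k\<bar>. x) = 0"
    using assms(2) by (auto simp: zmul_def split: if_splits)
  moreover have "0 < nat \<bar>k\<bar>" using assms(3) by simp
  ultimately show ?thesis using assms(1) unfolding torsion_free_def by blast
qed

lemma periodic_zmul:
  assumes "periodic a h"
  shows "periodic (zmul k a) h"
proof -
  have "h (x + zmul k a) = h x" for x
  proof (induction k arbitrary: x rule: int_induct[where k = 0])
    case (step1 i)
    then show ?case using assms by (simp add: zmul_add_1 periodic_def flip: add.assoc)
  next
    case (step2 i)
    have "h (x + zmul (i - 1) a) = h (x + zmul (i - 1) a + a)"
      using assms by (simp add: periodic_def)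
    then show ?case using step2 by (simp add: zmul_diff_1 algebra_simps)
  qed simp
  then show ?thesis by (simp add: periodic_def)
qed

section \<open>Commensurable elements and their common generators\<close>

definition commens :: "'a::ab_group_add \<Rightarrow> 'a \<Rightarrow> bool"
  where "commens a b \<longleftrightarrow> (\<exists>m n. m \<noteq> 0 \<and> n \<noteq> 0 \<and> zmul m a = zmul n b)"

lemma commens_refl: "commens a a"
  unfolding commens_def by (intro exI[of _ 1]) simp

lemma commens_sym: "commens a b \<Longrightarrow> commens b a"
  unfolding commens_def by metis

lemma commens_trans:
  assumes "commens a b" "commens b c"
  shows "commens a c"
proof -
  from assms obtain m n p q where "m \<noteq> 0" "n \<noteq> 0" "zmul m a = zmul n b"
    and "p \<noteq> 0" "q \<noteq> 0" "zmul p b = zmul q c" by (auto simp: commens_def)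
  then have "zmul (p * m) a = zmul (n * q) c"
    by (metis zmul_zmul mult.commute)
  with \<open>m \<noteq> 0\<close> \<open>n \<noteq> 0\<close> \<open>p \<noteq> 0\<close> \<open>q \<noteq> 0\<close> show ?thesis
    unfolding commens_def by (metis mult_eq_0_iff)
qed

lemma commens_zmul: "k \<noteq> 0 \<Longrightarrow> commens (zmul k a) a"
  unfolding commens_def by (intro exI[of _ 1] exI[of _ k]) simp

text \<open>Torsion-freeness allows the relation \<open>m a = n b\<close> to be divided by
  \<open>gcd m n\<close>, which gives \<open>p a = q b\<close> with \<open>p\<close>,
  \<open>q\<close> coprime. If \<open>u * p + v * q = 1\<close>, then \<open>e = v a + u b\<close>
  generates both elements.\<close>

lemma commens_common_generator:
  fixes a b :: "'a::ab_group_add"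
  assumes tf: "torsion_free TYPE('a)" and "commens a b"
  obtains e p q where "q \<noteq> 0" "a = zmul q e" "b = zmul p e"
proof -
  from assms obtain m n where mn: "m \<noteq> 0" "n \<noteq> 0" "zmul m a = zmul n b"
    by (auto simp: commens_def)
  define p where "p = m div gcd m n"
  define q where "q = n div gcd m n"
  have g: "gcd m n * p = m" "gcd m n * q = n" by (simp_all add: p_def q_def)
  then have "zmul (gcd m n) (zmul p a - zmul q b) = 0"
    using mn by (simp add: zmul.scale_right_diff_distrib)
  then have pq: "zmul p a = zmul q b"
    using zmul_eq_0D[OF tf] mn by fastforce
  have "coprime p q"
    using mn by (simp add: p_def q_def div_gcd_coprime)
  then obtain u v where uv: "u * p + v * q = 1"
    using bezout_int[of p q] by auto
  define e where "e = zmul v a + zmul u b"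
  have "zmul q e = zmul (v * q) a + zmul u (zmul q b)"
    by (simp add: e_def zmul_add_right mult.commute)
  also have "\<dots> = zmul (u * p + v * q) a"
    by (simp add: zmul_add add.commute flip: pq)
  finally have 1: "a = zmul q e" by (simp add: uv)
  have "zmul p e = zmul v (zmul p a) + zmul (u * p) b"
    by (simp add: e_def zmul_add_right mult.commute)
  also have "\<dots> = zmul (u * p + v * q) b"
    by (simp add: zmul_add add.commute pq)
  finally have 2: "b = zmul p e" by (simp add: uv)
  from mn g have "q \<noteq> 0" by auto
  with 1 2 show ?thesis using that by blast
qed

text \<open>Commensurability with \<open>c\<close> is carried through the induction: it makes the
  current generator commensurable with the next element, so that both are multiples of a finer
  generator.\<close>

lemma commens_finite_generator:
  fixes c :: "'a::ab_group_add"
  assumes tf: "torsion_free TYPE('a)" and "finite S" "\<forall>s\<in>S. commens s c"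
  shows "\<exists>e. commens e c \<and> (\<forall>s\<in>S. \<exists>k. s = zmul k e)"
  using assms(2,3)
proof (induction rule: finite_induct)
  case empty
  then show ?case using commens_refl by auto
next
  case (insert s S)
  then obtain e where e: "commens e c" "\<forall>s\<in>S. \<exists>k. s = zmul k e" by auto
  have "commens e s"
    using e insert.prems commens_sym commens_trans by blast
  then obtain e' p q where e': "q \<noteq> 0" "e = zmul q e'" "s = zmul p e'"
    using commens_common_generator[OF tf] by blast
  then have "commens e' c"
    using e commens_zmul commens_sym commens_trans by blast
  moreover have "\<exists>k. t = zmul k e'" if "t \<in> insert s S" for t
    using that e(2) e'(2,3) by (metis insert_iff zmul_zmul)
  ultimately show ?case by blast
qed

section \<open>Least common multiples of the elements \<open>x\<^sup>k - 1\<close>\<close>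

text \<open>The Euclidean algorithm on exponents, from
  \<open>x ^ k - 1 = x ^ (k - l) * (x ^ l - 1) + (x ^ (k - l) - 1)\<close> for
  \<open>l \<le> k\<close>.\<close>

lemma power_minus_1_bezout:
  fixes x :: "'r::comm_ring_1"
  shows "\<exists>s t. s * (x ^ k - 1) + t * (x ^ l - 1) = x ^ gcd k l - 1"
proof (induction "k + l" arbitrary: k l rule: less_induct)
  case less
  have step: "\<exists>s t. s * (x ^ k - 1) + t * (x ^ l - 1) = x ^ gcd k l - 1"
    if "0 < l" "l \<le> k" "k + l = n"
      and IH: "\<And>i j. i + j < n \<Longrightarrow> \<exists>s t. s * (x ^ i - 1) + t * (x ^ j - 1) = x ^ gcd i j - 1"
    for k l n
  proof -
    have "k - l + l < n" using that by simp
    from IH[OF this] obtain s t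
      where st: "s * (x ^ (k - l) - 1) + t * (x ^ l - 1) = x ^ gcd (k - l) l - 1" by blast
    have "x ^ k = x ^ (k - l) * x ^ l"
      using that(2) by (simp flip: power_add)
    then have "s * (x ^ k - 1) + (t - s * x ^ (k - l)) * (x ^ l - 1)
        = s * (x ^ (k - l) - 1) + t * (x ^ l - 1)"
      by (simp add: algebra_simps)
    also have "\<dots> = x ^ gcd k l - 1"
      using st that by (simp add: gcd_diff1_nat)
    finally show ?thesis by blast
  qed
  consider "k = 0" | "l = 0" | "0 < l" "l \<le> k" | "0 < k" "k \<le> l" by linarith
  then show ?case
  proof cases
    case 1
    then show ?thesis by (intro exI[of _ 0] exI[of _ 1]) simp
  next
    case 2
    then show ?thesis by (intro exI[of _ 1] exI[of _ 0]) simp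
  next
    case 3
    then show ?thesis using step[of l k "k + l"] less by blast
  next
    case 4
    then show ?thesis using step[of k l "l + k"] less
      by (metis add.commute gcd.commute)
  qed
qed

lemma power_minus_1_dvd:
  fixes x :: "'r::comm_ring_1"
  assumes "k dvd l"
  shows "x ^ k - 1 dvd x ^ l - 1"
proof -
  from assms obtain m where "l = k * m" by auto
  then show ?thesis
    by (auto simp: power_mult power_diff_1_eq)
qed

text \<open>\<open>L\<close> divides every \<open>Q i * X\<close>, and \<open>X\<close> is a
  combination of these. Thus a common multiple with comaximal cofactors is automatically a least
  one.\<close>

lemma comaximal_cofactors_dvd:
  fixes L :: "'r::comm_ring_1"
  assumes "\<forall>i\<in>I. L = E i * Q i" "(\<Sum>i\<in>I. S i * Q i) = 1" "\<forall>i\<in>I. E i dvd X"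
  shows "L dvd X"
proof -
  have "L dvd S i * Q i * X" if "i \<in> I" for i
  proof -
    from assms that have "L = E i * Q i" "E i dvd X" by auto
    then have "L dvd Q i * X" by (metis mult.commute mult_dvd_mono dvd_refl)
    then show ?thesis by (simp add: mult.assoc)
  qed
  then have "L dvd (\<Sum>i\<in>I. S i * Q i * X)" by (rule dvd_sum)
  also have "\<dots> = X" using assms(2) by (simp flip: sum_distrib_right)
  finally show ?thesis .
qed

text \<open>When a new exponent \<open>m\<close> is added, the lcm \<open>M\<close> of the \<open>x ^ gcd (k i) m - 1\<close> divides both
  \<open>L\<close> and \<open>x ^ m - 1\<close> and lies in the ideal they generate, so it plays the role of their gcd.\<close>

lemma power_minus_1_lcm:
  fixes x :: "'r::idom"
  assumes "finite I" "I \<noteq> {}" "\<forall>i\<in>I. k i > 0" and nz: "\<And>l. l > 0 \<Longrightarrow> x ^ l \<noteq> 1"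
  shows "\<exists>L Q S. (\<forall>i\<in>I. L = (x ^ k i - 1) * Q i) \<and> (\<Sum>i\<in>I. S i * Q i) = 1
    \<and> L dvd (\<Prod>i\<in>I. x ^ k i - 1)"
  using assms(1-3)
proof (induction arbitrary: k rule: finite_ne_induct)
  case (singleton i)
  show ?case
    by (intro exI[of _ "x ^ k i - 1"] exI[of _ "\<lambda>_. 1"]) simp
next
  case (insert j I)
  define E where "E i = x ^ k i - 1" for i
  define G where "G i = x ^ gcd (k i) (k j) - 1" for i
  from insert.IH[of k] insert.prems obtain L Q S where
    L: "\<forall>i\<in>I. L = E i * Q i" "(\<Sum>i\<in>I. S i * Q i) = 1" "L dvd (\<Prod>i\<in>I. E i)"
    unfolding E_def by auto
  from insert.IH[of "\<lambda>i. gcd (k i) (k j)"] insert.prems obtain M Q' S' where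
    M: "\<forall>i\<in>I. M = G i * Q' i" "(\<Sum>i\<in>I. S' i * Q' i) = 1"
    unfolding G_def by auto
  have "\<forall>i\<in>I. G i dvd L"
    using L(1) unfolding G_def E_def by (metis power_minus_1_dvd gcd_dvd1 dvd_mult2)
  then have "M dvd L" using comaximal_cofactors_dvd[OF M] by blast
  then obtain F where F: "L = M * F" by auto
  have "\<forall>i\<in>I. G i dvd E j"
    unfolding G_def E_def by (metis power_minus_1_dvd gcd_dvd2)
  then have "M dvd E j" using comaximal_cofactors_dvd[OF M] by blast
  then obtain H where H: "E j = M * H" by auto
  have "E j \<noteq> 0" using nz insert.prems by (simp add: E_def)
  with H have "M \<noteq> 0" by auto
  have "\<forall>i. \<exists>s t. s * E i + t * E j = G i"
    unfolding E_def G_def using power_minus_1_bezout by blast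
  then obtain s t where st: "\<And>i. s i * E i + t i * E j = G i" by metis
  \<comment> \<open>Collects the coefficients of \<open>L\<close> and \<open>E j\<close> when
    \<open>M = G i * Q' i\<close> and \<open>G i = s i * E i + t i * E j\<close> are inserted into
    the sum of the \<open>S i * Q i * M\<close>.\<close>
  define \<alpha> where "\<alpha> = (\<Sum>i\<in>I. S i * Q' i * s i)"
  define \<beta> where "\<beta> = (\<Sum>i\<in>I. S i * Q' i * t i * Q i)"
  have "M = (\<Sum>i\<in>I. S i * Q i * M)"
    using L(2) by (simp flip: sum_distrib_right)
  also have "\<dots> = (\<Sum>i\<in>I. S i * Q' i * s i * L + S i * Q' i * t i * Q i * E j)"
  proof (rule sum.cong)
    fix i assume "i \<in> I"
    then have "M = (s i * E i + t i * E j) * Q' i" "L = E i * Q i"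
      using M(1) L(1) st by auto
    then show "S i * Q i * M = S i * Q' i * s i * L + S i * Q' i * t i * Q i * E j"
      by (simp add: algebra_simps)
  qed simp
  also have "\<dots> = \<alpha> * L + \<beta> * E j"
    by (simp add: \<alpha>_def \<beta>_def sum.distrib sum_distrib_right)
  finally have "M * 1 = M * (\<alpha> * F + \<beta> * H)"
    using F H by (simp add: algebra_simps)
  with \<open>M \<noteq> 0\<close> have 1: "\<alpha> * F + \<beta> * H = 1" by simp
  \<comment> \<open>The new lcm is \<open>L * H = M * F * H = E j * F\<close>: the new element has
    cofactor \<open>F\<close>, and each old cofactor gains the factor \<open>H\<close>.\<close>
  define Qn where "Qn i = (if i = j then F else Q i * H)" for i
  define Sn where "Sn i = (if i = j then \<alpha> else \<beta> * S i)" for i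
  have "\<forall>i\<in>insert j I. L * H = E i * Qn i"
    using L(1) F H insert.hyps by (auto simp: Qn_def)
  moreover have "(\<Sum>i\<in>insert j I. Sn i * Qn i) = 1"
  proof -
    have "(\<Sum>i\<in>I. Sn i * Qn i) = (\<Sum>i\<in>I. \<beta> * H * (S i * Q i))"
      using insert.hyps by (intro sum.cong) (auto simp: Sn_def Qn_def)
    also have "\<dots> = \<beta> * H"
      using L(2) by (simp flip: sum_distrib_left)
    finally show ?thesis using insert.hyps 1 by (simp add: Sn_def Qn_def)
  qed
  moreover have "L * H dvd (\<Prod>i\<in>insert j I. E i)"
  proof -
    have "L * H dvd (\<Prod>i\<in>I. E i) * E j"
      using L(3) H by (intro mult_dvd_mono) auto
    then show ?thesis using insert.hyps by (simp add: mult.commute)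
  qed
  ultimately show ?case unfolding E_def by blast
qed

section \<open>Integer polynomials in a translation\<close>

text \<open>This is p(T) for the translation T by \<open>e\<close>. The values lie in any
  commutative ring, so that one operator acts both on the integer function and on its real
  summands.\<close>

definition act :: "'a::ab_group_add \<Rightarrow> int poly \<Rightarrow> ('a \<Rightarrow> 'b::comm_ring_1) \<Rightarrow> 'a \<Rightarrow> 'b"
  where "act e p f x = (\<Sum>i\<le>degree p. of_int (coeff p i) * f (x + zmul (int i) e))"

lemma act_0 [simp]: "act e 0 f x = 0"
  by (simp add: act_def)

lemma act_pCons [simp]: "act e (pCons c p) f x = of_int c * f x + act e p f (x + e)"
proof (cases "p = 0")
  case False
  then have "act e (pCons c p) f x = of_int c * f x +
      (\<Sum>i\<le>degree p. of_int (coeff p i) * f (x + zmul (int (Suc i)) e))"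
    unfolding act_def by (simp add: sum.atMost_Suc_shift del: of_nat_Suc sum.atMost_Suc)
  moreover have "x + zmul (int (Suc i)) e = x + e + zmul (int i) e" for i
    by (simp add: zmul_add add.assoc)
  ultimately show ?thesis by (simp add: act_def del: of_nat_Suc)
qed (simp add: act_def)

lemma act_1 [simp]: "act e 1 f x = f x"
  by (simp add: one_pCons)

lemma act_add: "act e (p + q) f x = act e p f x + act e q f x"
  by (induction p q arbitrary: x rule: poly_induct2) (simp_all add: algebra_simps)

lemma act_smult: "act e (smult c p) f x = of_int c * act e p f x"
  by (induction p arbitrary: x) (simp_all add: algebra_simps)

lemma act_diff: "act e (p - q) f x = act e p f x - act e q f x"
  using act_add[of e "p - q" q f x] by simp

lemma act_sum: "act e (\<Sum>i\<in>I. p i) f x = (\<Sum>i\<in>I. act e (p i) f x)"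
  by (induction I rule: infinite_finite_induct) (simp_all add: act_add)

lemma act_mult: "act e (p * q) f = act e p (act e q f)"
proof
  show "act e (p * q) f x = act e p (act e q f) x" for x
    by (induction p arbitrary: x) (simp_all add: act_add act_smult)
qed

text \<open>Links algebra and periodicity: \<open>[:0, 1:] ^ k - 1\<close> annihilates exactly the
  functions with period \<open>k e\<close>.\<close>

lemma act_power_minus_1: "act e ([:0, 1:] ^ k - 1) f x = f (x + zmul (int k) e) - f x"
proof -
  have "act e ([:0, 1:] ^ k) f x = f (x + zmul (int k) e)"
    by (induction k arbitrary: x) (simp_all add: act_mult zmul_add add.assoc)
  then show ?thesis by (simp add: act_diff)
qed

lemma act_zero_fun [simp]: "act e p (\<lambda>_. 0) x = 0"
  by (simp add: act_def)

lemma act_diff_fun: "act e p (\<lambda>y. f y - g y) x = act e p f x - act e p g x"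
  by (induction p arbitrary: x) (simp_all add: algebra_simps)

lemma act_sum_fun: "act e p (\<lambda>y. \<Sum>i\<in>I. f i y) x = (\<Sum>i\<in>I. act e p (f i) x)"
  by (induction p arbitrary: x) (simp_all add: sum.distrib sum_distrib_left)

lemma act_of_int: "act e p (\<lambda>y. of_int (f y)) x = of_int (act e p f x)"
  by (induction p arbitrary: x) simp_all

lemma periodic_act:
  assumes "periodic a f"
  shows "periodic a (act e p f)"
proof -
  have "act e p f (x + a) = act e p f x" for x
  proof (induction p arbitrary: x)
    case (pCons c p)
    have "x + a + e = (x + e) + a" by (simp add: algebra_simps)
    then have "act e p f (x + a + e) = act e p f (x + e)"
      by (simp only: pCons.IH)
    then show ?case using assms by (simp add: periodic_def)
  qed simp
  then show ?thesis by (simp add: periodic_def)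
qed

section \<open>Difference equations along an independent direction\<close>

lemma int_sum_exists:
  fixes u :: "int \<Rightarrow> 'b::ab_group_add"
  shows "\<exists>s. \<forall>n. s (n + 1) = s n + u n"
proof -
  \<comment> \<open>A signed partial sum: at least one of the two intervals is empty.\<close>
  define s where "s n = (\<Sum>i\<in>{0..<n}. u i) - (\<Sum>i\<in>{n..<0}. u i)" for n
  have "s (n + 1) = s n + u n" for n
  proof (cases "0 \<le> n")
    case True
    then have "{0..<n + 1} = insert n {0..<n}" by auto
    with True show ?thesis by (simp add: s_def add.commute)
  next
    case False
    then have "{n..<0} = insert n {n + 1..<0}" by auto
    with False show ?thesis by (simp add: s_def)
  qed
  then show ?thesis by blast
qed

text \<open>On a coset of the subgroup generated by \<open>a\<close> and \<open>b\<close>, the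
  hypothesis \<open>ind\<close> makes the coordinate along \<open>b\<close> unique. Summing
  \<open>h\<close> along \<open>b\<close> from a representative gives \<open>g\<close>. The
  coordinate along \<open>a\<close> may be ambiguous, but \<open>g\<close> ignores it.\<close>

lemma periodic_difference_solve:
  fixes h :: "'a::ab_group_add \<Rightarrow> 'b::ab_group_add"
  assumes per: "periodic a h" and ind: "\<And>m n. zmul m a = zmul n b \<Longrightarrow> n = 0"
  shows "\<exists>g. periodic a g \<and> (\<forall>x. g (x + b) - g x = h x)"
proof -
  define R where "R x y \<longleftrightarrow> (\<exists>m n. x = y + zmul m a + zmul n b)" for x y
  define r where "r x = (SOME y. R x y)" for x
  have "R x x" for x
    unfolding R_def by (intro exI[of _ 0]) simp
  then have Rr: "R x (r x)" for x
    unfolding r_def by (rule someI)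
  \<comment> \<open>Equality of the predicates, not mere equivalence of points, forces
    \<open>SOME\<close> to choose the same representative for \<open>x\<close>, \<open>x + a\<close>
    and \<open>x + b\<close>.\<close>
  have "R (x + a) = R x" "R (x + b) = R x" for x
  proof -
    have eq: "x + a = y + zmul (m + 1) a + zmul n b \<longleftrightarrow> x = y + zmul m a + zmul n b"
      "x + b = y + zmul m a + zmul (n + 1) b \<longleftrightarrow> x = y + zmul m a + zmul n b" for y m n
      by (auto simp: zmul_add_1 algebra_simps)
    show "R (x + a) = R x" unfolding R_def fun_eq_iff
      by (metis eq(1) diff_add_cancel)
    show "R (x + b) = R x" unfolding R_def fun_eq_iff
      by (metis eq(2) diff_add_cancel)
  qed
  then have r_add: "r (x + a) = r x" "r (x + b) = r x" for x
    by (simp_all add: r_def)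
  define N where "N x = (SOME n. \<exists>m. x = r x + zmul m a + zmul n b)" for x
  have N: "\<exists>m. x = r x + zmul m a + zmul (N x) b" for x
    using Rr[of x] unfolding R_def N_def
    by (metis (mono_tags, lifting) someI_ex)
  have N_eq: "N x = n" if "x = r x + zmul m a + zmul n b" for x m n
  proof -
    obtain m' where "x = r x + zmul m' a + zmul (N x) b" using N by blast
    with that have "r x + zmul m' a + zmul (N x) b = r x + zmul m a + zmul n b" by simp
    then have "zmul (m' - m) a = zmul (n - N x) b"
      by (simp add: zmul.scale_left_diff_distrib algebra_simps)
    then show ?thesis using ind by fastforce
  qed
  have "\<forall>y. \<exists>s. \<forall>n. s (n + 1) = s n + h (y + zmul n b)"
    using int_sum_exists[of "\<lambda>n. h (_ + zmul n b)"] by (rule allI)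
  then obtain s where s: "\<And>y n. s y (n + 1) = s y n + h (y + zmul n b)" by metis
  define g where "g x = s (r x) (N x)" for x
  have "g (x + a) = g x" for x
  proof -
    obtain m where "x = r x + zmul m a + zmul (N x) b" using N by blast
    then have "x + a = r (x + a) + zmul (m + 1) a + zmul (N x) b"
      unfolding r_add zmul_add_1 by (simp add: algebra_simps)
    then have "N (x + a) = N x" by (rule N_eq)
    then show ?thesis by (simp add: g_def r_add)
  qed
  moreover have "g (x + b) - g x = h x" for x
  proof -
    obtain m where m: "x = r x + zmul m a + zmul (N x) b" using N by blast
    then have "x + b = r (x + b) + zmul m a + zmul (N x + 1) b"
      unfolding r_add zmul_add_1 by (simp add: algebra_simps)
    then have "N (x + b) = N x + 1" by (rule N_eq)
    \<comment> \<open>The recurrence for \<open>s\<close> sees \<open>h\<close> only on the line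
      through \<open>r x\<close> along \<open>b\<close>; periodicity carries its value there over to
      \<open>x\<close>.\<close>
    moreover have "h x = h (r x + zmul (N x) b)"
    proof -
      have "h x = h (r x + zmul (N x) b + zmul m a)"
        by (subst m) (simp add: algebra_simps)
      also have "\<dots> = h (r x + zmul (N x) b)"
        using periodic_zmul[OF per] by (simp add: periodic_def)
      finally show ?thesis .
    qed
    ultimately show ?thesis by (simp add: g_def r_add s)
  qed
  ultimately show ?thesis unfolding periodic_def by blast
qed

text \<open>One factor at a time: each solution is again \<open>a\<close>-periodic and serves as the
  right-hand side for the remaining factors.\<close>

lemma periodic_act_prod_solve:
  fixes h :: "'a::ab_group_add \<Rightarrow> 'b::comm_ring_1"
  assumes "finite I" "\<forall>i\<in>I. k i > 0"
    and ind: "\<And>m n. zmul m a = zmul n e \<Longrightarrow> n = 0" and "periodic a h"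
  shows "\<exists>g. periodic a g \<and> act e (\<Prod>i\<in>I. [:0, 1:] ^ k i - 1) g = h"
  using assms(1,2,4)
proof (induction arbitrary: h rule: finite_induct)
  case empty
  then show ?case by (intro exI[of _ h]) auto
next
  case (insert i I)
  have "n = 0" if "zmul m a = zmul n (zmul (int (k i)) e)" for m n
    using ind[of m "n * int (k i)"] that insert.prems by simp
  then obtain h' where h': "periodic a h'" "\<And>x. h' (x + zmul (int (k i)) e) - h' x = h x"
    using periodic_difference_solve[OF insert.prems(2), of "zmul (int (k i)) e"] by blast
  then obtain g where "periodic a g" "act e (\<Prod>i\<in>I. [:0, 1:] ^ k i - 1) g = h'"
    using insert by blast
  moreover have "act e ([:0, 1:] ^ k i - 1) h' = h"
    using h'(2) by (simp add: act_power_minus_1 fun_eq_iff)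
  ultimately show ?case using insert.hyps by (auto simp: act_mult)
qed

section \<open>The decomposition\<close>

text \<open>Arbitrary finite index sets replace \<open>{1..n}\<close> because the induction passes
  to \<open>J - C\<close>, with a different \<open>f\<close> and \<open>F\<close>.\<close>

lemma integer_periodic_decomposition:
  fixes a :: "'i \<Rightarrow> 'a::ab_group_add" and f :: "'a \<Rightarrow> int" and F :: "'i \<Rightarrow> 'a \<Rightarrow> real"
  assumes tf: "torsion_free TYPE('a)" and "finite J"
    and "\<forall>j\<in>J. periodic (a j) (F j)" and "\<forall>x. real_of_int (f x) = (\<Sum>j\<in>J. F j x)"
  shows "\<exists>g :: 'i \<Rightarrow> 'a \<Rightarrow> int. (\<forall>j\<in>J. periodic (a j) (g j)) \<and> (\<forall>x. f x = (\<Sum>j\<in>J. g j x))"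
  using assms(2-4)
proof (induction J arbitrary: f F rule: finite_psubset_induct)
  case (psubset J)
  note perF = psubset.prems(1) and sumF = psubset.prems(2)
  consider "J = {}" | i where "i \<in> J" "a i = 0" | "J \<noteq> {}" "\<forall>j\<in>J. a j \<noteq> 0" by blast
  then show ?case
  proof cases
    case 1
    then show ?thesis using sumF by auto
  next
    \<comment> \<open>A zero period imposes no condition, so that one summand can be all of
      \<open>f\<close>.\<close>
    case (2 i)
    then show ?thesis using psubset.hyps
      by (intro exI[of _ "\<lambda>j x. if j = i then f x else 0"]) (auto simp: periodic_def)
  next
    case 3
    then obtain j0 where j0: "j0 \<in> J" by blast
    define C where "C = {j \<in> J. commens (a j) (a j0)}"
    have C: "j0 \<in> C" "C \<subseteq> J" "finite C"
      using j0 psubset.hyps by (auto simp: C_def commens_refl)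
    have "\<forall>s\<in>a ` C. commens s (a j0)" by (simp add: C_def)
    then obtain e where e: "commens e (a j0)" "\<forall>s\<in>a ` C. \<exists>l. s = zmul l e"
      using commens_finite_generator[OF tf, of "a ` C" "a j0"] C(3) by blast
    then have "\<forall>j\<in>C. \<exists>l. a j = zmul l e" by simp
    then obtain l where "\<forall>j\<in>C. a j = zmul (l j) e" by (rule bchoice[THEN exE])
    then have l: "a j = zmul (l j) e" if "j \<in> C" for j using that by blast
    \<comment> \<open>Exponents must be natural numbers, so signs are dropped here;
      \<open>kl\<close> restores them, since \<open>a j\<close> and its negative are periods of the
      same functions.\<close>
    define k where "k j = nat \<bar>l j\<bar>" for j
    have "l j \<noteq> 0" if "j \<in> C" for j
      using l[OF that] 3 C that by auto
    then have k: "\<forall>j\<in>C. k j > 0" by (auto simp: k_def)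
    have kl: "zmul (int (k j)) e = zmul (sgn (l j)) (a j)"
      "a j = zmul (sgn (l j)) (zmul (int (k j)) e)" if "j \<in> C" for j
      using l[OF that] by (simp_all add: k_def mult.commute abs_mult_sgn flip: abs_sgn)
    have "[:0, 1:] ^ m \<noteq> (1 :: int poly)" if "m > 0" for m
    proof
      assume "[:0, 1:] ^ m = (1 :: int poly)"
      then have "poly ([:0, 1:] ^ m) 0 = (1 :: int)" by simp
      with that show False by (simp add: power_0_left)
    qed
    then obtain L Q S where L: "\<forall>j\<in>C. L = ([:0, 1:] ^ k j - 1) * Q j"
      "(\<Sum>j\<in>C. S j * Q j) = (1 :: int poly)" "L dvd (\<Prod>j\<in>C. [:0, 1:] ^ k j - 1)"
      using power_minus_1_lcm[of C k "[:0, 1:] :: int poly"] C k by blast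
    from L(3) obtain P where P: "(\<Prod>j\<in>C. [:0, 1:] ^ k j - 1) = L * P" by auto
    have "act e L (F j) x = 0" if "j \<in> C" for j x
    proof -
      have "periodic (zmul (int (k j)) e) (F j)"
        using perF that C periodic_zmul kl(1) by (metis subsetD)
      then have "act e ([:0, 1:] ^ k j - 1) (F j) = (\<lambda>_. 0)"
        by (simp add: act_power_minus_1 periodic_def fun_eq_iff)
      moreover have "L = Q j * ([:0, 1:] ^ k j - 1)"
        using L(1) that by (simp add: mult.commute)
      ultimately show ?thesis by (simp add: act_mult)
    qed
    \<comment> \<open>The summands are real, but \<open>act e L f\<close> is integer valued, as the
      induction hypothesis requires.\<close>
    then have "real_of_int (act e L f x) = (\<Sum>j\<in>J - C. act e L (F j) x)" for x
    proof -
      have "real_of_int (act e L f x) = act e L (\<lambda>y. real_of_int (f y)) x"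
        by (simp add: act_of_int)
      also have "\<dots> = (\<Sum>j\<in>J. act e L (F j) x)"
        using sumF by (simp add: act_sum_fun)
      also have "\<dots> = (\<Sum>j\<in>J - C. act e L (F j) x)"
        using \<open>\<And>j x. j \<in> C \<Longrightarrow> act e L (F j) x = 0\<close> psubset.hyps
        by (intro sum.mono_neutral_right) auto
      finally show ?thesis .
    qed
    moreover have "J - C \<subset> J" using C by blast
    moreover have "\<forall>j\<in>J - C. periodic (a j) (act e L (F j))"
      using perF periodic_act by blast
    ultimately obtain h where h: "\<forall>j\<in>J - C. periodic (a j) (h j)"
      "\<And>x. act e L f x = (\<Sum>j\<in>J - C. h j x)"
      using psubset.IH[of "J - C" "\<lambda>j. act e L (F j)" "act e L f"] by blast
    have "\<exists>g. periodic (a j) g \<and> act e L g = h j" if "j \<in> J - C" for j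
    proof -
      \<comment> \<open>If \<open>n\<close> were nonzero, \<open>e \<noteq> 0\<close> and
        torsion-freeness would give \<open>m \<noteq> 0\<close>. Then \<open>a j\<close> would be
        commensurable with \<open>e\<close>, hence with \<open>a j0\<close>, and \<open>j\<close>
        would lie in \<open>C\<close>.\<close>
      have "n = 0" if "zmul m (a j) = zmul n e" for m n
      proof (rule ccontr)
        assume "n \<noteq> 0"
        have "e \<noteq> 0"
          using l[OF C(1)] 3 j0 by auto
        with \<open>n \<noteq> 0\<close> that have "m \<noteq> 0" using zmul_eq_0D[OF tf, of n e] by auto
        with \<open>n \<noteq> 0\<close> that have "commens (a j) e" unfolding commens_def by blast
        with e(1) have "commens (a j) (a j0)" by (rule commens_trans[rotated])
        with \<open>j \<in> J - C\<close> show False by (simp add: C_def)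
      qed
      then obtain y where y: "periodic (a j) y" "act e (\<Prod>j\<in>C. [:0, 1:] ^ k j - 1) y = h j"
        using periodic_act_prod_solve[OF C(3) k, of "a j" e "h j"] h(1) \<open>j \<in> J - C\<close> by blast
      \<comment> \<open>Since the product is \<open>L * P\<close>, the function
        \<open>act e P y\<close> is a solution for \<open>L\<close>, and it keeps the period
        \<open>a j\<close>.\<close>
      then show ?thesis
        unfolding P act_mult using periodic_act by blast
    qed
    then obtain g where g: "\<And>j. j \<in> J - C \<Longrightarrow> periodic (a j) (g j)"
      "\<And>j. j \<in> J - C \<Longrightarrow> act e L (g j) = h j" by metis
    define u where "u x = f x - (\<Sum>j\<in>J - C. g j x)" for x
    have Lu: "act e L u = (\<lambda>_. 0)"
      using g(2) h(2) by (simp add: u_def[abs_def] act_diff_fun act_sum_fun fun_eq_iff)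
    define v where "v j = act e (S j * Q j) u" for j
    have "periodic (a j) (v j)" if "j \<in> C" for j
    proof -
      \<comment> \<open>The factor completes \<open>Q j\<close> to \<open>L\<close>, which
        annihilates \<open>u\<close>.\<close>
      have "([:0, 1:] ^ k j - 1) * (S j * Q j) = S j * L"
        using L(1) that by simp
      then have "act e ([:0, 1:] ^ k j - 1) (v j) = act e (S j) (act e L u)"
        unfolding v_def by (metis act_mult)
      also have "\<dots> = (\<lambda>_. 0)"
        by (simp add: Lu fun_eq_iff)
      finally have "act e ([:0, 1:] ^ k j - 1) (v j) = (\<lambda>_. 0)" .
      then have "periodic (zmul (int (k j)) e) (v j)"
        by (simp add: act_power_minus_1 periodic_def fun_eq_iff)
      then show ?thesis using periodic_zmul kl(2)[OF that] by metis
    qed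
    moreover have "u x = (\<Sum>j\<in>C. v j x)" for x
      using act_sum[of e "\<lambda>j. S j * Q j" C u x] L(2) by (simp add: v_def)
    then have "f x = (\<Sum>j\<in>J. if j \<in> C then v j x else g j x)" for x
    proof -
      have "f x = (\<Sum>j\<in>C. v j x) + (\<Sum>j\<in>J - C. g j x)"
        using \<open>u x = (\<Sum>j\<in>C. v j x)\<close> by (simp add: u_def)
      also have "\<dots> = (\<Sum>j\<in>J. if j \<in> C then v j x else g j x)"
        using psubset.hyps C(2) by (simp add: sum.subset_diff[of C J])
      finally show ?thesis .
    qed
    ultimately show ?thesis using g(1)
      by (intro exI[of _ "\<lambda>j x. if j \<in> C then v j x else g j x"]) (auto simp: periodic_def)
  qed
qed

theorem corollary4p2:
  fixes n :: nat
    and a :: "nat \<Rightarrow> 'a::ab_group_add"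
    and f :: "'a \<Rightarrow> int"
  assumes "torsion_free TYPE('a)"
    and "\<exists>F :: nat \<Rightarrow> 'a \<Rightarrow> real.
           (\<forall>j\<in>{1..n}. periodic (a j) (F j)) \<and>
           (\<forall>x. real_of_int (f x) = (\<Sum>j=1..n. F j x))"
  shows "\<exists>g :: nat \<Rightarrow> 'a \<Rightarrow> int.
           (\<forall>j\<in>{1..n}. periodic (a j) (g j)) \<and>
           (\<forall>x. f x = (\<Sum>j=1..n. g j x))"
proof -
  from assms(2) obtain F :: "nat \<Rightarrow> 'a \<Rightarrow> real" where
    "\<forall>j\<in>{1..n}. periodic (a j) (F j)" "\<forall>x. real_of_int (f x) = (\<Sum>j=1..n. F j x)" by blast
  then show ?thesis
    using integer_periodic_decomposition[OF assms(1), of "{1..n}"] by blast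
qed

end
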